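(* Let $K$ be an edge-path connected simplicial complex, let $v_0$ be a vertex of $K$, and let $n\ge 2$. For $j\in\{1,\dots,n\}$ let $\tilde i_j:K\to K^n$ be the simplicial map which takes $\sigma$ to the $n$-tuple whose $j$-th factor is $\sigma$ and whose other factors are all $v_0$. Then $\mathrm{scat}(K)=\mathrm{SD}(\tilde i_1,\dots,\tilde i_n)$.
   Context: Simplicial complexes are abstract simplicial complexes. Two simplicial maps $\varphi,\psi:K\to L$ are contiguous if for every simplex $\{v_0,\dots,v_k\}$ of $K$ the set $\{\varphi(v_0),\dots,\varphi(v_k),\psi(v_0),\dots,\psi(v_k)\}$ is a simplex of $L$. They are in the same contiguity class, written $\varphi\sim\psi$, if there is a finite sequence of simplicial maps $K\to L$ from $\varphi$ to $\psi$ in which consecutive maps are contiguous. A simplicial complex is edge-path connected if any two vertices can be joined by a finite sequence of vertices in which consecutive vertices span an edge. For simplicial maps $\varphi_1,\dots,\varphi_n:K\to K'$, the $n$-th contiguity distance $\mathrm{SD}(\varphi_1,\dots,\varphi_n)$ is the least integer $k\ge 0$ such that $K$ is covered by subcomplexes $K_0,\dots,K_k$ with $\varphi_1|_{K_j},\dots,\varphi_n|_{K_j}:K_j\to K'$ all in the same contiguity class for each $j=0,\dots,k$; it is $\infty$ if there is no such covering. The categorical product $K^n$ has vertex set $V(K)^n$, and a finite nonempty set of vertices is a simplex of $K^n$ iff each of its $n$ coordinate projections is a simplex of $K$. The maps $\tilde i_j$ are given by the stated rule on vertices. A subcomplex $\Omega\subset K$ is categorical if the inclusion $\Omega\hookrightarrow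 K$ and a constant map $c_{v}:\Omega\to K$ at some vertex $v$ of $K$ are in the same contiguity class. The simplicial Lusternik-Schnirelmann category $\mathrm{scat}(K)$ is the least integer $k\ge 0$ such that $K$ is covered by categorical subcomplexes $\Omega_0,\dots,\Omega_k$ ($\infty$ if there is no such covering). *)

theory Defs
  imports Main "HOL-Library.FuncSet" "HOL-Library.Extended_Nat"
begin

text \<open>An abstract simplicial complex is represented by its set of (nonempty) simplices; it may be
  infinite or empty, and its vertices are exactly the elements of its simplices.\<close>

definition simplicial_complex :: "'a set set \<Rightarrow> bool" where
  "simplicial_complex K \<longleftrightarrow>
     (\<forall>s\<in>K. finite s \<and> s \<noteq> {}) \<and> (\<forall>s\<in>K. \<forall>t. t \<subseteq> s \<and> t \<noteq> {} \<longrightarrow> t \<in> K)"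

definition vertices :: "'a set set \<Rightarrow> 'a set" where
  "vertices K = \<Union>K"

definition subcomplex :: "'a set set \<Rightarrow> 'a set set \<Rightarrow> bool" where
  "subcomplex L K \<longleftrightarrow> simplicial_complex L \<and> L \<subseteq> K"

text \<open>Only the values on the vertices of \<open>K\<close> matter in the following notions, so the restriction
  of a map to a subcomplex \<open>L\<close> is the same function, considered with source \<open>L\<close>.\<close>

definition simplicial_map :: "'a set set \<Rightarrow> 'b set set \<Rightarrow> ('a \<Rightarrow> 'b) \<Rightarrow> bool" where
  "simplicial_map K L f \<longleftrightarrow> (\<forall>s\<in>K. f ` s \<in> L)"

definition contiguous :: "'a set set \<Rightarrow> 'b set set \<Rightarrow> ('a \<Rightarrow> 'b) \<Rightarrow> ('a \<Rightarrow> 'b) \<Rightarrow> bool" where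
  "contiguous K L f g \<longleftrightarrow>
     simplicial_map K L f \<and> simplicial_map K L g \<and> (\<forall>s\<in>K. f ` s \<union> g ` s \<in> L)"

definition same_contiguity_class ::
    "'a set set \<Rightarrow> 'b set set \<Rightarrow> ('a \<Rightarrow> 'b) \<Rightarrow> ('a \<Rightarrow> 'b) \<Rightarrow> bool" where
  "same_contiguity_class K L f g \<longleftrightarrow>
     (\<exists>(m::nat) h. h 0 = f \<and> h m = g \<and> (\<forall>i\<le>m. simplicial_map K L (h i)) \<and>
        (\<forall>i<m. contiguous K L (h i) (h (Suc i))))"

definition edge_path_connected :: "'a set set \<Rightarrow> bool" where
  "edge_path_connected K \<longleftrightarrow>
     (\<forall>u\<in>vertices K. \<forall>w\<in>vertices K. \<exists>(m::nat) p. p 0 = u \<and> p m = w \<and>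
        (\<forall>i<m. p i \<noteq> p (Suc i) \<and> {p i, p (Suc i)} \<in> K))"

definition SD_cover ::
    "nat \<Rightarrow> 'a set set \<Rightarrow> 'b set set \<Rightarrow> (nat \<Rightarrow> 'a \<Rightarrow> 'b) \<Rightarrow> nat \<Rightarrow> bool" where
  "SD_cover n K K' \<phi> k \<longleftrightarrow>
     (\<exists>L. (\<forall>j\<le>k. subcomplex (L j) K \<and>
              (\<forall>p\<in>{1..n}. \<forall>q\<in>{1..n}. same_contiguity_class (L j) K' (\<phi> p) (\<phi> q))) \<and>
          K = (\<Union>j\<le>k. L j))"

text \<open>The contiguity distance of the maps \<open>\<phi> 1, \<dots>, \<phi> n\<close> from \<open>K\<close> to \<open>K'\<close>.\<close>

definition SD :: "nat \<Rightarrow> 'a set set \<Rightarrow> 'b set set \<Rightarrow> (nat \<Rightarrow> 'a \<Rightarrow> 'b) \<Rightarrow> enat" where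
  "SD n K K' \<phi> = (if \<exists>k. SD_cover n K K' \<phi> k then enat (LEAST k. SD_cover n K K' \<phi> k) else \<infinity>)"

definition categorical :: "'a set set \<Rightarrow> 'a set set \<Rightarrow> bool" where
  "categorical \<Omega> K \<longleftrightarrow> subcomplex \<Omega> K \<and>
     (\<exists>v\<in>vertices K. same_contiguity_class \<Omega> K (\<lambda>x. x) (\<lambda>_. v))"

definition scat_cover :: "'a set set \<Rightarrow> nat \<Rightarrow> bool" where
  "scat_cover K k \<longleftrightarrow> (\<exists>\<Omega>. (\<forall>j\<le>k. categorical (\<Omega> j) K) \<and> K = (\<Union>j\<le>k. \<Omega> j))"

definition scat :: "'a set set \<Rightarrow> enat" where
  "scat K = (if \<exists>k. scat_cover K k then enat (LEAST k. scat_cover K k) else \<infinity>)"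

text \<open>The categorical product \<open>K\<^sup>n\<close>: an \<open>n\<close>-tuple of vertices is an extensional function
  on \<open>{1..n}\<close>.\<close>

definition power_complex :: "'a set set \<Rightarrow> nat \<Rightarrow> (nat \<Rightarrow> 'a) set set" where
  "power_complex K n =
     {S. finite S \<and> S \<noteq> {} \<and> S \<subseteq> ({1..n} \<rightarrow>\<^sub>E vertices K) \<and> (\<forall>i\<in>{1..n}. (\<lambda>x. x i) ` S \<in> K)}"

definition axis_map :: "nat \<Rightarrow> 'a \<Rightarrow> nat \<Rightarrow> 'a \<Rightarrow> (nat \<Rightarrow> 'a)" where
  "axis_map n v0 j = (\<lambda>v. \<lambda>i\<in>{1..n}. if i = j then v else v0)"

lemma vertex_singleton_simplex:
  assumes "simplicial_complex K" "v \<in> vertices K"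
  shows "{v} \<in> K"
proof -
  obtain s where s: "s \<in> K" "v \<in> s" using assms(2) unfolding vertices_def by auto
  then have "{v} \<subseteq> s" "{v} \<noteq> {}" by auto
  then show ?thesis using assms(1) s(1) unfolding simplicial_complex_def by metis
qed

lemma simplicial_complex_power_complex:
  assumes "simplicial_complex K"
  shows "simplicial_complex (power_complex K n)"
  unfolding simplicial_complex_def
proof (intro conjI ballI allI impI)
  fix S T assume S: "S \<in> power_complex K n" and T: "T \<subseteq> S \<and> T \<noteq> {}"
  have "(\<lambda>x. x i) ` T \<in> K" if "i \<in> {1..n}" for i
  proof -
    have "(\<lambda>x. x i) ` S \<in> K" using S that by (auto simp: power_complex_def)
    moreover have "(\<lambda>x. x i) ` T \<subseteq> (\<lambda>x. x i) ` S" "(\<lambda>x. x i) ` T \<noteq> {}" using T by auto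
    ultimately show ?thesis using assms unfolding simplicial_complex_def by blast
  qed
  then show "T \<in> power_complex K n"
    using S T finite_subset[of T S] unfolding power_complex_def by blast
qed (simp_all add: power_complex_def)

lemma vertices_power_complex:
  assumes "simplicial_complex K"
  shows "vertices (power_complex K n) = ({1..n} \<rightarrow>\<^sub>E vertices K)"
proof
  show "({1..n} \<rightarrow>\<^sub>E vertices K) \<subseteq> vertices (power_complex K n)"
  proof
    fix x assume x: "x \<in> ({1..n} \<rightarrow>\<^sub>E vertices K)"
    have "{x i} \<in> K" if "i \<in> {1..n}" for i
      using vertex_singleton_simplex[OF assms] PiE_mem[OF x that] by simp
    then have "{x} \<in> power_complex K n" using x by (auto simp: power_complex_def)
    then show "x \<in> vertices (power_complex K n)" unfolding vertices_def by blast
  qed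
  show "vertices (power_complex K n) \<subseteq> ({1..n} \<rightarrow>\<^sub>E vertices K)"
  proof
    fix x assume "x \<in> vertices (power_complex K n)"
    then obtain S where "S \<in> power_complex K n" "x \<in> S"
      by (subst (asm) vertices_def) (erule UnionE)
    then show "x \<in> ({1..n} \<rightarrow>\<^sub>E vertices K)"
      unfolding power_complex_def by blast
  qed
qed

lemma simplicial_map_axis_map:
  assumes "simplicial_complex K" "v0 \<in> vertices K"
  shows "simplicial_map K (power_complex K n) (axis_map n v0 j)"
  unfolding simplicial_map_def
proof
  fix s assume s: "s \<in> K"
  have fin: "finite s" "s \<noteq> {}" using assms s unfolding simplicial_complex_def by auto
  have v0: "{v0} \<in> K" using vertex_singleton_simplex[OF assms] .
  have sub: "axis_map n v0 j ` s \<subseteq> ({1..n} \<rightarrow>\<^sub>E vertices K)"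
    using s assms(2) unfolding axis_map_def vertices_def by auto
  have "(\<lambda>x. x i) ` axis_map n v0 j ` s \<in> K" if "i \<in> {1..n}" for i
  proof -
    have "(\<lambda>x. x i) ` axis_map n v0 j ` s = (if i = j then s else {v0})"
      using that fin by (auto simp: axis_map_def image_image)
    then show ?thesis using s v0 by simp
  qed
  then show "axis_map n v0 j ` s \<in> power_complex K n"
    using fin sub unfolding power_complex_def by auto
qed

end

theory Submission
  imports Defs
begin

text \<open>
  Both invariants count the members of a cover by subcomplexes of \<open>K\<close>, so it is enough to see that
  they admit the same members: a subcomplex \<open>\<Omega>\<close> is categorical iff all axis maps
  \<open>K \<rightarrow> K\<^sup>n\<close> lie in one contiguity class on \<open>\<Omega>\<close>
  (\<open>categorical_iff_axis_maps_contiguous\<close>).  Both directions come from the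
  fact that composition with a simplicial map preserves contiguity classes
  (\<open>same_contiguity_class_compose\<close>).

  If the inclusion of \<open>\<Omega>\<close> is in the class of a constant map, then edge-path connectedness lets that
  constant be moved to \<open>v\<^sub>0\<close>.  Composing with the \<open>p\<close>-th axis map connects the \<open>p\<close>-th axis map to the
  constant map at \<open>(v\<^sub>0, \<dots>, v\<^sub>0)\<close>.  That constant is the same for all \<open>p\<close>, so all axis maps are in
  its class.  Conversely, the first coordinate projection \<open>K\<^sup>n \<rightarrow> K\<close> turns the first axis map into the
  inclusion and the second one into the constant map at \<open>v\<^sub>0\<close>; the existence of a second axis is
  where \<open>n \<ge> 2\<close> enters.
\<close>

section \<open>Contiguity classes\<close>

text \<open>This form gives induction along a chain of contiguities.  The separate simpliciality conjunct
  accounts for the chain of length zero.\<close>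

lemma same_contiguity_class_iff_rtranclp:
  "same_contiguity_class K L f g \<longleftrightarrow> simplicial_map K L f \<and> (contiguous K L)\<^sup>*\<^sup>* f g"
proof
  assume "same_contiguity_class K L f g"
  then show "simplicial_map K L f \<and> (contiguous K L)\<^sup>*\<^sup>* f g"
    unfolding same_contiguity_class_def rtranclp_power relpowp_fun_conv by blast
next
  assume *: "simplicial_map K L f \<and> (contiguous K L)\<^sup>*\<^sup>* f g"
  then obtain m h where h: "h 0 = f" "h m = g" "\<forall>i<m. contiguous K L (h i) (h (Suc i))"
    unfolding rtranclp_power relpowp_fun_conv by blast
  have "simplicial_map K L (h i)" if "i \<le> m" for i
  proof (cases i)
    case 0
    then show ?thesis using * h by simp
  next
    case (Suc j)
    then show ?thesis using h(3) that by (auto simp: contiguous_def)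
  qed
  then show "same_contiguity_class K L f g"
    unfolding same_contiguity_class_def using h by blast
qed

lemma same_contiguity_class_refl:
  "simplicial_map K L f \<Longrightarrow> same_contiguity_class K L f f"
  by (simp add: same_contiguity_class_iff_rtranclp)

lemma same_contiguity_class_contiguous:
  "contiguous K L f g \<Longrightarrow> same_contiguity_class K L f g"
  by (auto simp: same_contiguity_class_iff_rtranclp contiguous_def)

lemma same_contiguity_class_trans:
  "same_contiguity_class K L f g \<Longrightarrow> same_contiguity_class K L g h \<Longrightarrow> same_contiguity_class K L f h"
  by (auto simp: same_contiguity_class_iff_rtranclp)

lemma contiguous_sym:
  "contiguous K L f g \<Longrightarrow> contiguous K L g f"
  by (simp add: contiguous_def Un_commute)

lemma same_contiguity_class_sym:
  assumes "same_contiguity_class K L f g"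
  shows "same_contiguity_class K L g f"
proof -
  have "simplicial_map K L f" "(contiguous K L)\<^sup>*\<^sup>* f g"
    using assms by (auto simp: same_contiguity_class_iff_rtranclp)
  from this(2,1) show ?thesis
  proof (induction rule: rtranclp_induct)
    case base
    then show ?case by (rule same_contiguity_class_refl)
  next
    case (step y z)
    then show ?case
      by (meson contiguous_sym same_contiguity_class_contiguous same_contiguity_class_trans)
  qed
qed

lemma contiguous_compose:
  assumes "contiguous K L f g" "simplicial_map L M \<theta>"
  shows "contiguous K M (\<lambda>x. \<theta> (f x)) (\<lambda>x. \<theta> (g x))"
  unfolding contiguous_def simplicial_map_def
proof (intro conjI ballI)
  fix s assume s: "s \<in> K"
  have fg: "f ` s \<in> L" "g ` s \<in> L" "f ` s \<union> g ` s \<in> L"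
    using assms(1) s by (auto simp: contiguous_def simplicial_map_def)
  have *: "\<theta> ` t \<in> M" if "t \<in> L" for t
    using assms(2) that by (simp add: simplicial_map_def)
  show "(\<lambda>x. \<theta> (f x)) ` s \<in> M" "(\<lambda>x. \<theta> (g x)) ` s \<in> M"
    using *[OF fg(1)] *[OF fg(2)] by (simp_all add: image_image)
  show "(\<lambda>x. \<theta> (f x)) ` s \<union> (\<lambda>x. \<theta> (g x)) ` s \<in> M"
    using *[OF fg(3)] by (simp add: image_Un image_image)
qed

lemma same_contiguity_class_compose:
  assumes "same_contiguity_class K L f g" "simplicial_map L M \<theta>"
  shows "same_contiguity_class K M (\<lambda>x. \<theta> (f x)) (\<lambda>x. \<theta> (g x))"
proof -
  have f: "simplicial_map K L f" and "(contiguous K L)\<^sup>*\<^sup>* f g"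
    using assms(1) by (auto simp: same_contiguity_class_iff_rtranclp)
  from this(2) show ?thesis
  proof (induction rule: rtranclp_induct)
    case base
    have "contiguous K L f f" using f by (simp add: contiguous_def simplicial_map_def)
    then show ?case by (intro same_contiguity_class_contiguous contiguous_compose[OF _ assms(2)])
  next
    case (step y z)
    from step.IH same_contiguity_class_contiguous[OF contiguous_compose[OF step.hyps(2) assms(2)]]
    show ?case by (rule same_contiguity_class_trans)
  qed
qed

section \<open>Constant maps, coordinate projections and axis maps\<close>

lemma simplicial_map_const:
  assumes "simplicial_complex L" "simplicial_complex K" "u \<in> vertices K"
  shows "simplicial_map L K (\<lambda>_. u)"
  using vertex_singleton_simplex[OF assms(2,3)] assms(1)
  by (auto simp: simplicial_map_def simplicial_complex_def image_constant_conv)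

text \<open>An edge path from \<open>u\<close> to \<open>w\<close> is a chain of constant maps in which consecutive ones are
  contiguous, because their joint image on any simplex is an edge.\<close>

lemma same_contiguity_class_const:
  assumes "simplicial_complex L" "simplicial_complex K" "edge_path_connected K"
    and "u \<in> vertices K" "w \<in> vertices K"
  shows "same_contiguity_class L K (\<lambda>_. u) (\<lambda>_. w)"
proof -
  obtain m p where p: "p 0 = u" "p m = w" "\<And>i. i < m \<Longrightarrow> {p i, p (Suc i)} \<in> K"
    using assms(3-5) unfolding edge_path_connected_def by metis
  have "same_contiguity_class L K (\<lambda>_. u) (\<lambda>_. p i)" if "i \<le> m" for i
    using that
  proof (induction i)
    case 0
    then show ?case
      using same_contiguity_class_refl[OF simplicial_map_const[OF assms(1,2,4)]] p(1) by simp
  next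
    case (Suc i)
    have e: "{p i, p (Suc i)} \<in> K" using p(3) Suc.prems by simp
    then have v: "p i \<in> vertices K" "p (Suc i) \<in> vertices K" by (auto simp: vertices_def)
    have "contiguous L K (\<lambda>_. p i) (\<lambda>_. p (Suc i))"
      unfolding contiguous_def
    proof (intro conjI ballI simplicial_map_const assms(1,2) v)
      fix s assume "s \<in> L"
      then have "s \<noteq> {}" using assms(1) by (auto simp: simplicial_complex_def)
      then have "(\<lambda>_. p i) ` s \<union> (\<lambda>_. p (Suc i)) ` s = {p i, p (Suc i)}" by auto
      then show "(\<lambda>_. p i) ` s \<union> (\<lambda>_. p (Suc i)) ` s \<in> K" using e by simp
    qed
    then show ?case
      using Suc same_contiguity_class_contiguous same_contiguity_class_trans
      by (metis Suc_leD)
  qed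
  then show ?thesis using p(2) by blast
qed

lemma simplicial_map_projection:
  "i \<in> {1..n} \<Longrightarrow> simplicial_map (power_complex K n) K (\<lambda>x. x i)"
  by (simp add: simplicial_map_def power_complex_def)

lemma axis_map_basepoint:
  "axis_map n v0 p v0 = axis_map n v0 q v0"
  by (simp add: axis_map_def)

section \<open>Categorical subcomplexes\<close>

lemma categorical_iff_axis_maps_contiguous:
  assumes K: "simplicial_complex K" "edge_path_connected K" and v0: "v0 \<in> vertices K"
    and n: "n \<ge> 2"
  shows "categorical \<Omega> K \<longleftrightarrow> subcomplex \<Omega> K \<and>
    (\<forall>p\<in>{1..n}. \<forall>q\<in>{1..n}.
       same_contiguity_class \<Omega> (power_complex K n) (axis_map n v0 p) (axis_map n v0 q))"
    (is "_ \<longleftrightarrow> _ \<and> ?axes")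
proof
  assume "categorical \<Omega> K"
  then obtain v where sub: "subcomplex \<Omega> K" and v: "v \<in> vertices K"
    and contract: "same_contiguity_class \<Omega> K (\<lambda>x. x) (\<lambda>_. v)"
    unfolding categorical_def by blast
  have "simplicial_complex \<Omega>" using sub by (simp add: subcomplex_def)
  then have "same_contiguity_class \<Omega> K (\<lambda>x. x) (\<lambda>_. v0)"
    using same_contiguity_class_trans[OF contract same_contiguity_class_const] K v v0 by blast
  then have to_base: "same_contiguity_class \<Omega> (power_complex K n)
      (axis_map n v0 p) (\<lambda>_. axis_map n v0 p v0)" for p
    by (rule same_contiguity_class_compose[OF _ simplicial_map_axis_map[OF K(1) v0]])
  have "same_contiguity_class \<Omega> (power_complex K n) (axis_map n v0 p) (axis_map n v0 q)" for p q
    using to_base[of p] same_contiguity_class_sym[OF to_base[of q]]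
    unfolding axis_map_basepoint[of n v0 p q] by (rule same_contiguity_class_trans)
  then show "subcomplex \<Omega> K \<and> ?axes" using sub by blast
next
  assume *: "subcomplex \<Omega> K \<and> ?axes"
  then have "same_contiguity_class \<Omega> (power_complex K n) (axis_map n v0 1) (axis_map n v0 2)"
    using n by simp
  then have "same_contiguity_class \<Omega> K (\<lambda>x. axis_map n v0 1 x 1) (\<lambda>x. axis_map n v0 2 x 1)"
    by (rule same_contiguity_class_compose[OF _ simplicial_map_projection]) (use n in simp)
  then have "same_contiguity_class \<Omega> K (\<lambda>x. x) (\<lambda>_. v0)"
    using n by (simp add: axis_map_def)
  then show "categorical \<Omega> K"
    using * v0 unfolding categorical_def by blast
qed

theorem theorem3p4:
  fixes K :: "'a set set" and v0 :: 'a and n :: nat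
  assumes "simplicial_complex K"
    and "edge_path_connected K"
    and "v0 \<in> vertices K"
    and "n \<ge> 2"
  shows "scat K = SD n K (power_complex K n) (\<lambda>j. axis_map n v0 j)"
proof -
  have "scat_cover K = SD_cover n K (power_complex K n) (\<lambda>j. axis_map n v0 j)"
    unfolding scat_cover_def SD_cover_def categorical_iff_axis_maps_contiguous[OF assms]
    by (rule ext) (rule refl)
  then show ?thesis unfolding scat_def SD_def by simp
qed

end
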